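(* Let $f=\sum_{i=1}^m f_i$ with $f_i:\mathbb{R}^n\to\mathbb{R}$, $f^*=\min_{x\in\mathbb{R}^n} f(x)$ finite and $\mathcal{X}^*=\{x\in\mathbb{R}^n : f(x)=f^*\}$ nonempty. Let $\{x_i(k)\}_{k\ge 1}$, $i=1,\dots,m$, be generated from arbitrary initial points $x_i(1)\in\mathbb{R}^n$ by $$x_i(k+1)=\sum_{j=1}^m w_{ij}(k)\,x_j(k)-\alpha_k\, g_{i,\delta}(k),\qquad k\ge 1,$$ where $(f_{i,\delta}(k),g_{i,\delta}(k))\in\mathbb{R}\times\mathbb{R}^n$ is the pair returned at time $k$ by a first-order $(\delta_k,L_k)$-oracle of $f_i$ at the point $x_i(k)$, and let $x_{\rm av}(k)=\frac1m\sum_{i=1}^m x_i(k)$. Suppose that: (1) each $f_i$ is convex and continuous and, for every $k\ge 1$, admits a first-order $(\delta_k,L_k)$-oracle, where $\delta_k\ge 0$ and $L_k\le L$ for all $k$ for some constant $L>0$; (2) there is a constant $C>0$ with $\|g_{i,\delta}(k)\|\le C$ for all $k\ge 1$ and all $i=1,\dots,m$; (3) the undirected communication graph $\mathcal{G}_k$ is connected for every $k\ge 1$; (4) for every $k\ge1$ the matrix $W(k)=[w_{ij}(k)]_{m\times m}$ is doubly stochastic, and there is a constant $\eta>0$ (independent of $k$) such that for all $i$, $w_{ii}(k)\ge\eta$, and $w_{ij}(k)\ge\eta$ whenever $(j,i)\in\mathcal{E}_k$; (5) the step sizes $\alpha_k$ are positive and satisfy $$\sum_{k=1}^\infty\alpha_k=\infty,\qquad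 \sum_{k=1}^\infty\alpha_k^2<\infty,\qquad \sum_{k=1}^\infty\alpha_k\delta_k<\infty.$$ Then: a) for every $x^*\in\mathcal{X}^*$, the sequence $\{\|x_{\rm av}(k)-x^*\|\}_{k\ge1}$ converges; b) there exists a cluster point $\bar x_{\rm av}$ of the sequence $\{x_{\rm av}(k)\}$ such that $\bar x_{\rm av}\in\mathcal{X}^*$; c) if the minimizer of $f$ is unique, $\mathcal{X}^*=\{x^*\}$, then $\lim_{k\to\infty}x_i(k)=x^*$ for each $i=1,\dots,m$.
   Context: A convex function $h:\mathbb{R}^n\to\mathbb{R}$ admits a first-order $(\delta,L)$-oracle (with accuracy $\delta\ge 0$) if for any point $x\in\mathbb{R}^n$ one has a pair $(h_{\delta,L}(x),g_{\delta,L}(x))\in\mathbb{R}\times\mathbb{R}^n$ such that $$0\le h(y)-h_{\delta,L}(x)-g_{\delta,L}(x)^\top(y-x)\le \frac{L}{2}\|y-x\|^2+\delta\quad\text{for all } y\in\mathbb{R}^n.$$ Here $h$ need not be differentiable. There are $m$ agents. For each time $k\ge1$, $\mathcal{G}_k$ is an undirected graph with node set $\{1,\dots,m\}$ and edge set $\mathcal{E}_k$; $(i,j)\in\mathcal{E}_k$ means agents $i$ and $j$ can communicate at time $k$. The weights $w_{ij}(k)$ are nonnegative, with $w_{ij}(k)>0$ if and only if agent $i$ receives information from agent $j$ at time $k$ (i.e. $i=j$ or $(j,i)\in\mathcal{E}_k$). A square matrix is doubly stochastic if its entries are nonnegative and all its rows and columns sum to $1$. $\|\cdot\|$ is the Euclidean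 norm. *)

theory Defs
  imports "HOL-Analysis.Analysis"
begin

definition oracle_pair ::
  "(real ^ 'n \<Rightarrow> real) \<Rightarrow> real \<Rightarrow> real \<Rightarrow> real ^ 'n \<Rightarrow> real \<times> (real ^ 'n) \<Rightarrow> bool" where
  "oracle_pair h \<delta> L x p \<longleftrightarrow>
     (\<forall>y. 0 \<le> h y - fst p - snd p \<bullet> (y - x) \<and>
          h y - fst p - snd p \<bullet> (y - x) \<le> L / 2 * (norm (y - x))\<^sup>2 + \<delta>)"

definition admits_oracle :: "(real ^ 'n \<Rightarrow> real) \<Rightarrow> real \<Rightarrow> real \<Rightarrow> bool" where
  "admits_oracle h \<delta> L \<longleftrightarrow> (\<forall>x. \<exists>p. oracle_pair h \<delta> L x p)"

text \<open>An undirected graph on the vertex set \<open>UNIV\<close> is a symmetric set of ordered pairs.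
  Self-loops are not excluded.\<close>

definition undirected_graph :: "('v \<times> 'v) set \<Rightarrow> bool" where
  "undirected_graph E \<longleftrightarrow> sym E"

definition connected_graph :: "('v \<times> 'v) set \<Rightarrow> bool" where
  "connected_graph E \<longleftrightarrow> (\<forall>u v. (u, v) \<in> E\<^sup>*)"

definition doubly_stochastic :: "real ^ 'm ^ 'm \<Rightarrow> bool" where
  "doubly_stochastic W \<longleftrightarrow>
     (\<forall>i j. 0 \<le> W $ i $ j) \<and>
     (\<forall>i. (\<Sum>j\<in>UNIV. W $ i $ j) = 1) \<and>
     (\<forall>j. (\<Sum>i\<in>UNIV. W $ i $ j) = 1)"

definition cluster_point :: "(nat \<Rightarrow> 'a::topological_space) \<Rightarrow> 'a \<Rightarrow> bool" where
  "cluster_point s l \<longleftrightarrow> (\<exists>r. strict_mono r \<and> (s \<circ> r) \<longlonglongrightarrow> l)"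

end

theory Submission
  imports Defs
begin

text \<open>
  Write \<open>z k\<close> for the average of the agents' points at time \<open>k\<close> and \<open>V k\<close> for the sum of
  their squared distances to \<open>z k\<close>. The proof separates agreement (\<open>V\<close> is small) from
  optimality (\<open>z\<close> approaches the minimizers), and treats both by the same principle: if
  \<open>a (k + 1) \<le> a k - b k + e k\<close> with \<open>a, b \<ge> 0\<close> and \<open>e\<close> summable, then \<open>a\<close> converges and
  \<open>b\<close> is summable (\<open>quasi_decreasing_convergent_summable\<close>).

  Agreement. A doubly stochastic matrix keeps the average, and the sum of squared norms
  decreases by exactly the variances within its rows. Since the diagonal and edge weights are at least \<open>\<eta>\<close>, this
  loss is at least a multiple of the energy of \<open>x\<close> along the edges; since the graph is
  connected, the edge energy controls the whole dispersion. So one mixing step shrinks \<open>V\<close> by a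
  factor \<open>1 - c\<close> independent of time (\<open>dispersion_doubly_stochastic_le\<close>). The gradient step
  slightly weakens this factor and adds at most a multiple of \<open>\<alpha>\<^sup>2\<close>, hence \<open>V\<close> is summable.

  Optimality. The average makes a step along the average of the \<open>g i\<close>, each of which was computed
  at \<open>x i\<close> rather than at \<open>z\<close>. The lower bound in \<^const>\<open>oracle_pair\<close>, taken at a minimizer \<open>y\<close>,
  and the upper bound, taken at \<open>z\<close>, combine to an inequality in which the unknown model value
  cancels (\<open>oracle_pair_inner_le\<close>); the price of evaluating at the wrong point is quadratic
  in the distance from \<open>x i\<close> to \<open>z\<close>, so its total is a multiple of \<open>V\<close>. This gives
  \<open>\<parallel>z (k + 1) - y\<parallel>\<^sup>2 \<le> \<parallel>z k - y\<parallel>\<^sup>2 - 2 \<alpha> / m (F (z k) - fstar) + e k\<close> with summable \<open>e\<close>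
  (\<open>average_step_distance_le\<close>). Consequently the distance to each minimizer converges, and
  \<open>\<Sum> \<alpha> (F (z k) - fstar)\<close> is finite while \<open>\<Sum> \<alpha>\<close> is not, so \<open>F (z k)\<close> tends to \<open>fstar\<close>
  along a subsequence. As \<open>z\<close> is bounded, a further subsequence converges, and its limit is a
  minimizer by continuity. If the minimizer is unique, the distance from \<open>z\<close> to it
  converges and has limit zero along a subsequence, hence tends to zero; the agents follow
  because \<open>V\<close> tends to zero.
\<close>

section \<open>Average and dispersion of a family of vectors\<close>

definition avg :: "('m::finite \<Rightarrow> 'a::real_inner) \<Rightarrow> 'a" where
  "avg v = (1 / real CARD('m)) *\<^sub>R (\<Sum>i\<in>UNIV. v i)"

definition dispersion :: "('m::finite \<Rightarrow> 'a::real_inner) \<Rightarrow> real" where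
  "dispersion v = (\<Sum>i\<in>UNIV. (norm (v i - avg v))\<^sup>2)"

lemma dispersion_nonneg: "0 \<le> dispersion v"
  by (simp add: dispersion_def sum_nonneg)

lemma norm_diff_avg_le_dispersion: "(norm (v i - avg v))\<^sup>2 \<le> dispersion v"
  unfolding dispersion_def by (rule member_le_sum) auto

lemma sum_eq_avg: "(\<Sum>i\<in>UNIV. v i) = real CARD('m) *\<^sub>R avg (v :: 'm::finite \<Rightarrow> 'a::real_inner)"
  by (simp add: avg_def)

lemma avg_diff: "avg (\<lambda>i. u i - w i) = avg u - avg w"
  by (simp add: avg_def sum_subtractf scaleR_diff_right)

lemma avg_scaleR: "avg (\<lambda>i. c *\<^sub>R u i) = c *\<^sub>R avg u"
  by (simp add: avg_def scaleR_sum_right [symmetric])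

text \<open>
  Turns a bound on all pairwise differences into a bound on the deviations from the average.
\<close>

lemma diff_avg_eq: "v i - avg v = avg (\<lambda>j. v i - v j)"
  by (simp add: avg_def sum_subtractf scaleR_diff_right sum_constant_scaleR)

lemma norm_avg_le:
  fixes v :: "'m::finite \<Rightarrow> 'a::real_inner"
  assumes "\<And>i. norm (v i) \<le> B"
  shows "norm (avg v) \<le> B"
proof -
  have "norm (\<Sum>i\<in>UNIV. v i) \<le> real CARD('m) * B"
    using sum_norm_le [of UNIV v "\<lambda>_. B"] assms by simp
  then show ?thesis
    by (simp add: avg_def field_simps)
qed

text \<open>
  The average is the point with the smallest sum of squared distances; here it is compared with
  the origin.
\<close>

lemma dispersion_le_sum_norm_squares:
  fixes v :: "'m::finite \<Rightarrow> 'a::real_inner"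
  shows "dispersion v \<le> (\<Sum>i\<in>UNIV. (norm (v i))\<^sup>2)"
proof -
  have "dispersion v = (\<Sum>i\<in>UNIV. v i \<bullet> v i - 2 * (v i \<bullet> avg v) + avg v \<bullet> avg v)"
    unfolding dispersion_def
    by (rule sum.cong) (simp_all add: power2_norm_eq_inner inner_diff_left inner_diff_right inner_commute)
  also have "\<dots> = (\<Sum>i\<in>UNIV. v i \<bullet> v i) - 2 * ((\<Sum>i\<in>UNIV. v i) \<bullet> avg v) + CARD('m) * (avg v \<bullet> avg v)"
    by (simp add: sum.distrib sum_subtractf sum_distrib_left [symmetric] inner_sum_left)
  also have "\<dots> = (\<Sum>i\<in>UNIV. v i \<bullet> v i) - CARD('m) * (avg v \<bullet> avg v)"
    by (simp add: sum_eq_avg)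
  also have "\<dots> \<le> (\<Sum>i\<in>UNIV. v i \<bullet> v i)"
    by simp
  finally show ?thesis
    by (simp add: power2_norm_eq_inner)
qed

text \<open>
  Young's inequality. The free parameter \<open>t\<close> lets a contraction of \<open>a\<close> survive the perturbation
  by \<open>b\<close>: the factor of \<open>a\<close> can be taken as close to 1 as the contraction requires.
\<close>

lemma norm_diff_square_le:
  fixes a b :: "'a::real_inner"
  assumes "t > 0"
  shows "(norm (a - b))\<^sup>2 \<le> (1 + t) * (norm a)\<^sup>2 + (1 + 1 / t) * (norm b)\<^sup>2"
proof -
  \<comment> \<open>the difference of the two sides of the claim is this quotient\<close>
  have "0 \<le> (norm (t *\<^sub>R a + b))\<^sup>2 / t"
    using assms by simp
  also have "\<dots> = t * (a \<bullet> a) + 2 * (a \<bullet> b) + (b \<bullet> b) / t"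
    using assms
    by (simp add: power2_norm_eq_inner inner_add_left inner_add_right inner_commute field_simps)
  finally show ?thesis
    by (simp add: power2_norm_eq_inner inner_diff_left inner_diff_right inner_commute algebra_simps)
qed

lemma dispersion_diff_le:
  assumes "t > 0"
  shows "dispersion (\<lambda>i. u i - w i) \<le> (1 + t) * dispersion u + (1 + 1 / t) * dispersion w"
proof -
  have "dispersion (\<lambda>i. u i - w i) = (\<Sum>i\<in>UNIV. (norm ((u i - avg u) - (w i - avg w)))\<^sup>2)"
    by (simp add: dispersion_def avg_diff algebra_simps)
  also have "\<dots> \<le> (\<Sum>i\<in>UNIV. (1 + t) * (norm (u i - avg u))\<^sup>2 + (1 + 1 / t) * (norm (w i - avg w))\<^sup>2)"
    by (intro sum_mono norm_diff_square_le assms)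
  finally show ?thesis
    by (simp add: dispersion_def sum.distrib sum_distrib_left)
qed

text \<open>
  The variance identity: averaging decreases the squared norm by exactly half the weighted sum of
  the squared pairwise differences.
\<close>

lemma norm_square_convex_combination:
  fixes v :: "'j \<Rightarrow> 'a::real_inner"
  assumes "(\<Sum>j\<in>A. p j) = 1"
  shows "(norm (\<Sum>j\<in>A. p j *\<^sub>R v j))\<^sup>2 =
    (\<Sum>j\<in>A. p j * (norm (v j))\<^sup>2) - (\<Sum>j\<in>A. \<Sum>l\<in>A. p j * p l * (norm (v j - v l))\<^sup>2) / 2"
proof -
  have "(\<Sum>j\<in>A. \<Sum>l\<in>A. p j * p l * (norm (v j - v l))\<^sup>2) =
     (\<Sum>j\<in>A. \<Sum>l\<in>A. p j * (v j \<bullet> v j) * p l + p j * (p l * (v l \<bullet> v l))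
        - 2 * ((p j *\<^sub>R v j) \<bullet> (p l *\<^sub>R v l)))"
    by (intro sum.cong refl)
       (simp add: power2_norm_eq_inner inner_diff_left inner_diff_right inner_commute algebra_simps)
  also have "\<dots> = 2 * (\<Sum>j\<in>A. p j * (v j \<bullet> v j))
      - 2 * ((\<Sum>j\<in>A. p j *\<^sub>R v j) \<bullet> (\<Sum>l\<in>A. p l *\<^sub>R v l))"
    unfolding sum.distrib sum_subtractf sum_distrib_left [symmetric] sum_distrib_right [symmetric]
      inner_sum_right [symmetric] inner_sum_left [symmetric]
    by (simp add: assms)
  finally show ?thesis
    unfolding power2_norm_eq_inner by linarith
qed

section \<open>Contraction of the dispersion by mixing over a connected graph\<close>

lemma norm_diff_le_relpow:
  assumes "(a, b) \<in> E ^^ n" and "\<And>j l. (j, l) \<in> E \<Longrightarrow> norm (v j - v l) \<le> d"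
  shows "norm (v a - v b :: 'a::real_normed_vector) \<le> real n * d"
  using assms(1)
proof (induction n arbitrary: b)
  case 0
  then show ?case by simp
next
  case (Suc n)
  then obtain c where c: "(a, c) \<in> E ^^ n" "(c, b) \<in> E"
    by auto
  have "norm (v a - v b) \<le> norm (v a - v c) + norm (v c - v b)"
    using norm_triangle_ineq [of "v a - v c" "v c - v b"] by simp
  also have "\<dots> \<le> real n * d + d"
    using Suc.IH [OF c(1)] assms(2) [OF c(2)] by simp
  finally show ?case
    by (simp add: algebra_simps)
qed

text \<open>
  A Poincare inequality on a connected graph. Any two vertices are joined by a path with at most
  \<open>m\<^sup>2\<close> edges, a crude bound on the number of edges that suffices here because the constant only
  has to depend on \<open>m\<close> alone. Along each edge the values differ by at most the square root
  of the edge energy \<open>S\<close>; so all deviations are at most \<open>m\<^sup>2 \<surd>S\<close>, and summing the squares over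
  the \<open>m\<close> vertices gives the factor \<open>m\<^sup>5\<close>.
\<close>

lemma dispersion_le_edge_energy:
  fixes v :: "'m::finite \<Rightarrow> 'a::real_inner" and E :: "('m \<times> 'm) set"
  assumes "connected_graph E"
  shows "dispersion v \<le> real CARD('m) ^ 5 * (\<Sum>(j, l)\<in>E. (norm (v j - v l))\<^sup>2)"
proof -
  define S where "S = (\<Sum>(j, l)\<in>E. (norm (v j - v l))\<^sup>2)"
  have S0: "0 \<le> S"
    unfolding S_def by (auto intro: sum_nonneg)
  have edge: "norm (v j - v l) \<le> sqrt S" if "(j, l) \<in> E" for j l
  proof -
    have "(norm (v j - v l))\<^sup>2 \<le> S"
      unfolding S_def using member_le_sum [OF that, of "\<lambda>(j, l). (norm (v j - v l))\<^sup>2"] by auto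
    then show ?thesis
      by (simp add: real_le_rsqrt)
  qed
  have "card E \<le> card (UNIV :: ('m \<times> 'm) set)"
    by (rule card_mono) auto
  then have cardE: "card E \<le> CARD('m) ^ 2"
    by (simp add: card_prod power2_eq_square)
  have pair: "norm (v a - v b) \<le> real (CARD('m) ^ 2) * sqrt S" for a b
  proof -
    have "(a, b) \<in> E\<^sup>*"
      using assms by (simp add: connected_graph_def)
    then obtain n0 where "(a, b) \<in> E ^^ n0"
      using rtrancl_imp_relpow by blast
    then obtain n where n: "(a, b) \<in> E ^^ n" "n \<le> card E"
      using relpow_finite_bounded [of E n0] by auto
    have "norm (v a - v b) \<le> real n * sqrt S"
      using norm_diff_le_relpow [OF n(1)] edge by blast
    also have "\<dots> \<le> real (CARD('m) ^ 2) * sqrt S"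
      using n(2) cardE S0 by (intro mult_right_mono) auto
    finally show ?thesis .
  qed
  have "dispersion v \<le> (\<Sum>i\<in>(UNIV::'m set). (real (CARD('m) ^ 2) * sqrt S)\<^sup>2)"
    unfolding dispersion_def
  proof (intro sum_mono power_mono norm_ge_zero)
    fix i
    show "norm (v i - avg v) \<le> real (CARD('m) ^ 2) * sqrt S"
      unfolding diff_avg_eq by (rule norm_avg_le) (rule pair)
  qed
  also have "\<dots> = real CARD('m) ^ 5 * S"
    using S0 by (simp add: power_mult_distrib eval_nat_numeral)
  finally show ?thesis
    by (simp add: S_def)
qed

lemma doubly_stochasticD:
  assumes "doubly_stochastic W"
  shows "0 \<le> W $ i $ j" "(\<Sum>j\<in>UNIV. W $ i $ j) = 1" "(\<Sum>i\<in>UNIV. W $ i $ j) = 1"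
  using assms by (auto simp: doubly_stochastic_def)

lemma avg_doubly_stochastic:
  assumes "doubly_stochastic W"
  shows "avg (\<lambda>i. \<Sum>j\<in>UNIV. W $ i $ j *\<^sub>R v j) = avg v"
proof -
  have "(\<Sum>i\<in>UNIV. \<Sum>j\<in>UNIV. W $ i $ j *\<^sub>R v j) = (\<Sum>j\<in>UNIV. \<Sum>i\<in>UNIV. W $ i $ j *\<^sub>R v j)"
    by (rule sum.swap)
  also have "\<dots> = (\<Sum>j\<in>UNIV. v j)"
    by (simp add: scaleR_sum_left [symmetric] doubly_stochasticD [OF assms])
  finally show ?thesis
    by (simp add: avg_def)
qed

text \<open>
  The rows of \<open>W\<close> sum to 1, so the variance identity applies to each of them; the columns sum
  to 1, so the main terms add up to the old dispersion. In the subtracted double sums the pair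
  \<open>(j, l)\<close> has the total weight \<open>\<Sum>i. W i j * W i l\<close>. If \<open>(j, l)\<close> is an edge, the summand
  \<open>i = l\<close>, a product of an edge weight and a diagonal weight, already contributes \<open>\<eta>\<^sup>2\<close>.
\<close>

lemma dispersion_doubly_stochastic_le:
  fixes v :: "'m::finite \<Rightarrow> 'a::real_inner" and W :: "real ^ 'm ^ 'm"
  assumes W: "doubly_stochastic W" and conn: "connected_graph E" and "0 \<le> \<eta>"
    and diag: "\<And>i. \<eta> \<le> W $ i $ i" and edge: "\<And>i j. (j, i) \<in> E \<Longrightarrow> \<eta> \<le> W $ i $ j"
  shows "dispersion (\<lambda>i. \<Sum>j\<in>UNIV. W $ i $ j *\<^sub>R v j)
           \<le> (1 - \<eta>\<^sup>2 / (2 * real CARD('m) ^ 5)) * dispersion v"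
proof -
  define u where "u j = v j - avg v" for j
  define S where "S = (\<Sum>(j, l)\<in>E. (norm (v j - v l))\<^sup>2)"
  have dev: "(\<Sum>j\<in>UNIV. W $ i $ j *\<^sub>R v j) - avg v = (\<Sum>j\<in>UNIV. W $ i $ j *\<^sub>R u j)" for i
    by (simp add: u_def scaleR_diff_right sum_subtractf scaleR_sum_left [symmetric]
        doubly_stochasticD [OF W])
  have "dispersion (\<lambda>i. \<Sum>j\<in>UNIV. W $ i $ j *\<^sub>R v j)
      = (\<Sum>i\<in>UNIV. (norm (\<Sum>j\<in>UNIV. W $ i $ j *\<^sub>R u j))\<^sup>2)"
    by (simp add: dispersion_def avg_doubly_stochastic [OF W] dev)
  also have "\<dots> = (\<Sum>i\<in>UNIV. (\<Sum>j\<in>UNIV. W $ i $ j * (norm (u j))\<^sup>2)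
      - (\<Sum>j\<in>UNIV. \<Sum>l\<in>UNIV. W $ i $ j * W $ i $ l * (norm (v j - v l))\<^sup>2) / 2)"
    by (simp add: norm_square_convex_combination doubly_stochasticD [OF W] u_def)
  also have "\<dots> = (\<Sum>i\<in>UNIV. \<Sum>j\<in>UNIV. W $ i $ j * (norm (u j))\<^sup>2)
      - (\<Sum>i\<in>UNIV. \<Sum>j\<in>UNIV. \<Sum>l\<in>UNIV. W $ i $ j * W $ i $ l * (norm (v j - v l))\<^sup>2) / 2"
    by (simp add: sum_subtractf sum_divide_distrib)
  also have "(\<Sum>i\<in>UNIV. \<Sum>j\<in>UNIV. W $ i $ j * (norm (u j))\<^sup>2) = dispersion v"
    by (subst sum.swap)
       (simp add: sum_distrib_right [symmetric] doubly_stochasticD [OF W] dispersion_def u_def)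
  finally have split: "dispersion (\<lambda>i. \<Sum>j\<in>UNIV. W $ i $ j *\<^sub>R v j) = dispersion v
      - (\<Sum>i\<in>UNIV. \<Sum>j\<in>UNIV. \<Sum>l\<in>UNIV. W $ i $ j * W $ i $ l * (norm (v j - v l))\<^sup>2) / 2" .
  have "\<eta>\<^sup>2 * S = (\<Sum>(j, l)\<in>E. \<eta>\<^sup>2 * (norm (v j - v l))\<^sup>2)"
    by (simp add: S_def sum_distrib_left case_prod_unfold)
  also have "\<dots> \<le> (\<Sum>(j, l)\<in>E. \<Sum>i\<in>UNIV. W $ i $ j * W $ i $ l * (norm (v j - v l))\<^sup>2)"
  proof (rule sum_mono, clarify)
    fix j l
    assume "(j, l) \<in> E"
    then have "\<eta>\<^sup>2 \<le> W $ l $ j * W $ l $ l"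
      unfolding power2_eq_square using diag edge \<open>0 \<le> \<eta>\<close> doubly_stochasticD(1) [OF W]
      by (intro mult_mono) auto
    then have "\<eta>\<^sup>2 * (norm (v j - v l))\<^sup>2 \<le> W $ l $ j * W $ l $ l * (norm (v j - v l))\<^sup>2"
      by (rule mult_right_mono) simp
    also have "\<dots> \<le> (\<Sum>i\<in>UNIV. W $ i $ j * W $ i $ l * (norm (v j - v l))\<^sup>2)"
      by (rule member_le_sum [where f = "\<lambda>i. W $ i $ j * W $ i $ l * (norm (v j - v l))\<^sup>2"])
         (simp_all add: doubly_stochasticD(1) [OF W])
    finally show "\<eta>\<^sup>2 * (norm (v j - v l))\<^sup>2
        \<le> (\<Sum>i\<in>UNIV. W $ i $ j * W $ i $ l * (norm (v j - v l))\<^sup>2)" .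
  qed
  also have "\<dots> \<le> (\<Sum>(j, l)\<in>UNIV \<times> UNIV. \<Sum>i\<in>UNIV. W $ i $ j * W $ i $ l * (norm (v j - v l))\<^sup>2)"
    by (rule sum_mono2) (auto intro!: sum_nonneg simp: doubly_stochasticD(1) [OF W])
  also have "\<dots> = (\<Sum>j\<in>UNIV. \<Sum>l\<in>UNIV. \<Sum>i\<in>UNIV. W $ i $ j * W $ i $ l * (norm (v j - v l))\<^sup>2)"
    by (rule sum.cartesian_product [symmetric])
  also have "\<dots> = (\<Sum>j\<in>UNIV. \<Sum>i\<in>UNIV. \<Sum>l\<in>UNIV. W $ i $ j * W $ i $ l * (norm (v j - v l))\<^sup>2)"
    by (intro sum.cong refl sum.swap)
  also have "\<dots> = (\<Sum>i\<in>UNIV. \<Sum>j\<in>UNIV. \<Sum>l\<in>UNIV. W $ i $ j * W $ i $ l * (norm (v j - v l))\<^sup>2)"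
    by (rule sum.swap)
  finally have drop: "dispersion (\<lambda>i. \<Sum>j\<in>UNIV. W $ i $ j *\<^sub>R v j) \<le> dispersion v - \<eta>\<^sup>2 * S / 2"
    using split by simp
  have "\<eta>\<^sup>2 * dispersion v \<le> \<eta>\<^sup>2 * (real CARD('m) ^ 5 * S)"
    unfolding S_def by (intro mult_left_mono dispersion_le_edge_energy conn) simp
  then have "\<eta>\<^sup>2 / (2 * real CARD('m) ^ 5) * dispersion v \<le> \<eta>\<^sup>2 * S / 2"
    by (simp add: field_simps)
  with drop show ?thesis
    by (simp add: algebra_simps)
qed

section \<open>Two facts about real sequences\<close>

text \<open>
  A deterministic form of the Robbins--Siegmund lemma. Subtracting the partial sums of \<open>e\<close> from
  \<open>a\<close> leaves a decreasing sequence that is bounded below, because \<open>a\<close> is nonnegative and these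
  partial sums are bounded.
\<close>

lemma quasi_decreasing_convergent_summable:
  fixes a b e :: "nat \<Rightarrow> real"
  assumes a0: "\<And>k. 0 \<le> a k" and b0: "\<And>k. 0 \<le> b k" and e: "summable e"
    and step: "\<And>k. a (Suc k) \<le> a k - b k + e k"
  shows "convergent a" "summable b"
proof -
  obtain B where B: "\<And>n. (\<Sum>k<n. e k) \<le> B"
  proof -
    have "Bseq (\<lambda>n. \<Sum>k<n. e k)"
      using e by (simp add: summable_iff_convergent convergent_imp_Bseq)
    then obtain K where "\<And>n. norm (\<Sum>k<n. e k) \<le> K"
      by (auto simp: Bseq_def)
    then show ?thesis
      using that by (metis abs_le_D1 real_norm_def)
  qed
  have sum_b: "a n + (\<Sum>k<n. b k) \<le> a 0 + (\<Sum>k<n. e k)" for n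
  proof (induction n)
    case (Suc n)
    then show ?case using step [of n] by simp
  qed simp
  show "summable b"
  proof (rule summableI_nonneg_bounded [OF b0])
    fix n
    show "(\<Sum>k<n. b k) \<le> a 0 + B"
      using sum_b [of n] a0 [of n] B [of n] by simp
  qed
  define d where "d n = a n - (\<Sum>k<n. e k)" for n
  have "decseq d"
    unfolding d_def decseq_Suc_iff
  proof
    fix n
    show "a (Suc n) - (\<Sum>k<Suc n. e k) \<le> a n - (\<Sum>k<n. e k)"
      using step [of n] b0 [of n] by simp
  qed
  moreover have "- B \<le> d n" for n
    using a0 [of n] B [of n] by (simp add: d_def)
  ultimately obtain l where "d \<longlonglongrightarrow> l"
    using decseq_convergent by blast
  then have "convergent d"
    by (rule convergentI)
  moreover have "convergent (\<lambda>n. \<Sum>k<n. e k)"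
    using e by (simp add: summable_iff_convergent)
  ultimately have "convergent (\<lambda>n. d n + (\<Sum>k<n. e k))"
    by (rule convergent_add)
  then show "convergent a"
    by (simp add: d_def)
qed

text \<open>
  If \<open>b\<close> stayed above some \<open>t > 0\<close> from some index on, then \<open>a\<close> would be dominated by \<open>a * b / t\<close>
  and hence summable. So \<open>b\<close> is small infinitely often, which allows a subsequence to be chosen
  step by step.
\<close>

lemma weighted_summable_subseq_tendsto_zero:
  fixes a b :: "nat \<Rightarrow> real"
  assumes a0: "\<And>k. 0 \<le> a k" and b0: "\<And>k. 0 \<le> b k"
    and ab: "summable (\<lambda>k. a k * b k)" and a: "\<not> summable a"
  shows "\<exists>r::nat \<Rightarrow> nat. strict_mono r \<and> (b \<circ> r) \<longlonglongrightarrow> 0"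
proof -
  have small: "\<exists>n\<ge>N. b n < t" if "t > 0" for t :: real and N
  proof (rule ccontr)
    assume "\<not> (\<exists>n\<ge>N. b n < t)"
    then have "norm (a n) \<le> (1 / t) * (a n * b n)" if "n \<ge> N" for n
      using that \<open>t > 0\<close> a0 [of n] mult_left_mono [of t "b n" "a n"]
      by (simp add: field_simps not_less)
    moreover have "summable (\<lambda>n. (1 / t) * (a n * b n))"
      by (rule summable_mult [OF ab])
    ultimately have "summable a"
      using summable_comparison_test' by blast
    with a show False ..
  qed
  have "\<exists>r::nat \<Rightarrow> nat. \<forall>n. b (r n) < 1 / real (Suc n) \<and> r n < r (Suc n)"
  proof (rule dependent_nat_choice)
    show "\<exists>x. b x < 1 / real (Suc 0)"
      using small [of 1 0] by auto
  next
    fix x n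
    show "\<exists>y. b y < 1 / real (Suc (Suc n)) \<and> x < y"
      using small [of "1 / real (Suc (Suc n))" "Suc x"] by (auto simp: Suc_le_eq)
  qed
  then obtain r :: "nat \<Rightarrow> nat" where r: "\<And>n. b (r n) < 1 / real (Suc n)" "\<And>n. r n < r (Suc n)"
    by blast
  have "(b \<circ> r) \<longlonglongrightarrow> 0"
  proof (rule tendsto_sandwich)
    show "\<forall>\<^sub>F n in sequentially. 0 \<le> (b \<circ> r) n"
      using b0 by simp
    show "\<forall>\<^sub>F n in sequentially. (b \<circ> r) n \<le> 1 / real (Suc n)"
      using r(1) by (intro always_eventually allI) (simp add: less_imp_le)
    show "(\<lambda>n. 1 / real (Suc n)) \<longlonglongrightarrow> 0"
      using LIMSEQ_inverse_real_of_nat by (simp add: inverse_eq_divide)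
  qed simp
  with r(2) show ?thesis
    by (auto simp: strict_mono_Suc_iff)
qed

section \<open>One step of the averaged subgradient method\<close>

text \<open>
  Both bounds of \<^const>\<open>oracle_pair\<close> are used, at different points: \<open>y\<close> for the lower and \<open>z\<close> for
  the upper one. The model value \<open>c\<close> occurs in both and cancels. So \<open>g\<close>, although computed at
  \<open>x\<close>, acts as a subgradient of \<open>h\<close> at \<open>z\<close> up to \<open>\<delta>\<close> and an error quadratic in \<open>x - z\<close>.
\<close>

lemma oracle_pair_inner_le:
  assumes "oracle_pair h \<delta> L x (c, g)" and "L \<le> M"
  shows "- (g \<bullet> (z - y)) \<le> h y - h z + \<delta> + M / 2 * (norm (x - z))\<^sup>2"
proof -
  have "0 \<le> h y - c - g \<bullet> (y - x)"
    and "h z - c - g \<bullet> (z - x) \<le> L / 2 * (norm (z - x))\<^sup>2 + \<delta>"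
    using assms(1) by (auto simp: oracle_pair_def)
  moreover have "L / 2 * (norm (z - x))\<^sup>2 \<le> M / 2 * (norm (x - z))\<^sup>2"
    using assms(2) by (simp add: norm_minus_commute mult_right_mono)
  ultimately show ?thesis
    by (simp add: inner_diff_right)
qed

text \<open>
  Expanding the square, the cross term is the mean over \<open>i\<close> of the inner products estimated in
  \<open>oracle_pair_inner_le\<close>, taken at the common point \<open>z = avg p\<close>; the quadratic errors add up to
  the dispersion of the points \<open>p i\<close>.
\<close>

lemma average_step_distance_le:
  fixes g p :: "'m::finite \<Rightarrow> real ^ 'n"
  assumes pair: "\<And>i. oracle_pair (f i) \<delta> L (p i) (c i, g i)" and "L \<le> M"
    and g: "\<And>i. norm (g i) \<le> C" and "0 \<le> \<alpha>"
  shows "(norm (avg p - \<alpha> *\<^sub>R avg g - y))\<^sup>2 \<le> (norm (avg p - y))\<^sup>2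
     - 2 * \<alpha> / real CARD('m) * ((\<Sum>i\<in>UNIV. f i (avg p)) - (\<Sum>i\<in>UNIV. f i y))
     + (2 * (\<alpha> * \<delta>) + \<alpha> * M / real CARD('m) * dispersion p + \<alpha>\<^sup>2 * C\<^sup>2)"
proof -
  let ?m = "real CARD('m)" and ?z = "avg p"
  have "?m * - (avg g \<bullet> (?z - y)) = (\<Sum>i\<in>UNIV. - (g i \<bullet> (?z - y)))"
    by (simp add: avg_def inner_sum_left sum_negf)
  also have "\<dots> \<le> (\<Sum>i\<in>UNIV. f i y - f i ?z + \<delta> + M / 2 * (norm (p i - ?z))\<^sup>2)"
    by (intro sum_mono oracle_pair_inner_le [OF pair \<open>L \<le> M\<close>])
  also have "\<dots> = (\<Sum>i\<in>UNIV. f i y) - (\<Sum>i\<in>UNIV. f i ?z) + ?m * \<delta> + M / 2 * dispersion p"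
    by (simp add: sum.distrib sum_subtractf sum_distrib_left dispersion_def)
  finally have "- (avg g \<bullet> (?z - y)) \<le>
      ((\<Sum>i\<in>UNIV. f i y) - (\<Sum>i\<in>UNIV. f i ?z) + ?m * \<delta> + M / 2 * dispersion p) / ?m"
    by (simp add: field_simps)
  then have "2 * \<alpha> * - (avg g \<bullet> (?z - y)) \<le> 2 * \<alpha> *
      (((\<Sum>i\<in>UNIV. f i y) - (\<Sum>i\<in>UNIV. f i ?z) + ?m * \<delta> + M / 2 * dispersion p) / ?m)"
    using \<open>0 \<le> \<alpha>\<close> by (intro mult_left_mono) auto
  also have "\<dots> = - 2 * \<alpha> / ?m * ((\<Sum>i\<in>UNIV. f i ?z) - (\<Sum>i\<in>UNIV. f i y))
      + 2 * (\<alpha> * \<delta>) + \<alpha> * M / ?m * dispersion p"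
    by (simp add: field_simps)
  finally have cross: "2 * \<alpha> * - (avg g \<bullet> (?z - y)) \<le> \<dots>" .
  have "(norm (?z - \<alpha> *\<^sub>R avg g - y))\<^sup>2 = (norm ((?z - y) - \<alpha> *\<^sub>R avg g))\<^sup>2"
    by (simp add: algebra_simps)
  also have "\<dots> = (norm (?z - y))\<^sup>2 + 2 * \<alpha> * - (avg g \<bullet> (?z - y)) + \<alpha>\<^sup>2 * (norm (avg g))\<^sup>2"
    unfolding power2_norm_eq_inner
    by (simp add: inner_diff_left inner_diff_right inner_commute power2_eq_square algebra_simps)
  also have "\<alpha>\<^sup>2 * (norm (avg g))\<^sup>2 \<le> \<alpha>\<^sup>2 * C\<^sup>2"
    using norm_avg_le [of g C] g by (intro mult_left_mono power_mono) auto
  finally show ?thesis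
    using cross by simp
qed

section \<open>Convergence of the distributed method\<close>

theorem theorem5:
  fixes f :: "'m::finite \<Rightarrow> real ^ 'n \<Rightarrow> real"
    and F :: "real ^ 'n \<Rightarrow> real"
    and fstar :: real
    and Xstar :: "(real ^ 'n) set"
    and E :: "nat \<Rightarrow> ('m \<times> 'm) set"
    and W :: "nat \<Rightarrow> real ^ 'm ^ 'm"
    and x :: "'m \<Rightarrow> nat \<Rightarrow> real ^ 'n"
    and xav :: "nat \<Rightarrow> real ^ 'n"
    and fd :: "'m \<Rightarrow> nat \<Rightarrow> real"
    and gd :: "'m \<Rightarrow> nat \<Rightarrow> real ^ 'n"
    and \<alpha> \<delta> L :: "nat \<Rightarrow> real"
    and Lmax C \<eta> :: real
  assumes F: "\<And>y. F y = (\<Sum>i\<in>UNIV. f i y)"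
    and fstar_lower: "\<And>y. fstar \<le> F y"
    and Xstar: "Xstar = {y. F y = fstar}"
    and Xstar_nonempty: "Xstar \<noteq> {}"
    and graph: "\<And>k. k \<ge> 1 \<Longrightarrow> undirected_graph (E k)"
    and weight_nonneg: "\<And>k i j. k \<ge> 1 \<Longrightarrow> W k $ i $ j \<ge> 0"
    and weight_pos: "\<And>k i j. k \<ge> 1 \<Longrightarrow> W k $ i $ j > 0 \<longleftrightarrow> i = j \<or> (j, i) \<in> E k"
    and iteration: "\<And>k i. k \<ge> 1 \<Longrightarrow>
          x i (k + 1) = (\<Sum>j\<in>UNIV. W k $ i $ j *\<^sub>R x j k) - \<alpha> k *\<^sub>R gd i k"
    and oracle_output: "\<And>k i. k \<ge> 1 \<Longrightarrow>
          oracle_pair (f i) (\<delta> k) (L k) (x i k) (fd i k, gd i k)"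
    and average: "\<And>k. k \<ge> 1 \<Longrightarrow> xav k = (1 / real CARD('m)) *\<^sub>R (\<Sum>i\<in>UNIV. x i k)"
    and convex: "\<And>i. convex_on UNIV (f i)"
    and continuous: "\<And>i. continuous_on UNIV (f i)"
    and oracle_exists: "\<And>k i. k \<ge> 1 \<Longrightarrow> admits_oracle (f i) (\<delta> k) (L k)"
    and delta_nonneg: "\<And>k. k \<ge> 1 \<Longrightarrow> \<delta> k \<ge> 0"
    and Lmax_pos: "Lmax > 0"
    and L_bound: "\<And>k. k \<ge> 1 \<Longrightarrow> L k \<le> Lmax"
    and C_pos: "C > 0"
    and g_bound: "\<And>k i. k \<ge> 1 \<Longrightarrow> norm (gd i k) \<le> C"
    and connected: "\<And>k. k \<ge> 1 \<Longrightarrow> connected_graph (E k)"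
    and stochastic: "\<And>k. k \<ge> 1 \<Longrightarrow> doubly_stochastic (W k)"
    and eta_pos: "\<eta> > 0"
    and eta_diag: "\<And>k i. k \<ge> 1 \<Longrightarrow> W k $ i $ i \<ge> \<eta>"
    and eta_edge: "\<And>k i j. k \<ge> 1 \<Longrightarrow> (j, i) \<in> E k \<Longrightarrow> W k $ i $ j \<ge> \<eta>"
    and step_pos: "\<And>k. k \<ge> 1 \<Longrightarrow> \<alpha> k > 0"
    and step_diverge: "filterlim (\<lambda>K. \<Sum>k=1..K. \<alpha> k) at_top sequentially"
    and step_square: "summable (\<lambda>k. (\<alpha> (Suc k))\<^sup>2)"
    and step_delta: "summable (\<lambda>k. \<alpha> (Suc k) * \<delta> (Suc k))"
  shows "(\<forall>xstar\<in>Xstar. convergent (\<lambda>k. norm (xav k - xstar))) \<and>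
         (\<exists>xbar. cluster_point xav xbar \<and> xbar \<in> Xstar) \<and>
         (\<forall>xstar. Xstar = {xstar} \<longrightarrow> (\<forall>i. (\<lambda>k. x i k) \<longlonglongrightarrow> xstar))"
proof -
  let ?m = "real CARD('m)"
  \<comment> \<open>Time starts at 1; the shift by \<open>Suc\<close> gives sequences that satisfy the recursions from index 0 on.\<close>
  define a where "a k = \<alpha> (Suc k)" for k
  define P where "P k i = x i (Suc k)" for k i
  define G where "G k i = gd i (Suc k)" for k i
  define z where "z k = avg (P k)" for k
  define V where "V k = dispersion (P k)" for k
  define mix where "mix k i = (\<Sum>j\<in>UNIV. W (Suc k) $ i $ j *\<^sub>R P k j)" for k i
  have a_pos: "a k > 0" for k
    using step_pos [of "Suc k"] by (simp add: a_def)
  have z: "xav (Suc k) = z k" for k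
    using average [of "Suc k"] by (simp add: z_def avg_def P_def)
  have P_Suc: "P (Suc k) = (\<lambda>i. mix k i - a k *\<^sub>R G k i)" for k
    using iteration [of "Suc k"] by (auto simp: P_def mix_def a_def G_def)
  have G_le: "norm (G k i) \<le> C" for k i
    using g_bound [of "Suc k"] by (simp add: G_def)
  have avg_mix: "avg (mix k) = z k" for k
    using avg_doubly_stochastic [OF stochastic [of "Suc k"], of "P k"] by (simp add: mix_def [abs_def] z_def)
  have z_Suc: "z (Suc k) = z k - a k *\<^sub>R avg (G k)" for k
    by (simp add: z_def [of "Suc k"] P_Suc avg_diff avg_scaleR avg_mix)
  have V_nonneg: "0 \<le> V k" for k
    by (simp add: V_def dispersion_nonneg)

  have sum_a2: "summable (\<lambda>k. (a k)\<^sup>2)"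
    using step_square by (simp add: a_def)
  \<comment> \<open>the contraction rate of one mixing step\<close>
  define c where "c = \<eta>\<^sup>2 / (2 * ?m ^ 5)"
  have c_pos: "c > 0"
    using eta_pos by (simp add: c_def)
  \<comment> \<open>Young's inequality with parameter \<open>c\<close>, since \<open>(1 + c) * (1 - c) = 1 - c\<^sup>2\<close> is still below 1\<close>
  have V_Suc: "V (Suc k) \<le> V k - c\<^sup>2 * V k + (1 + 1 / c) * (?m * C\<^sup>2) * (a k)\<^sup>2" for k
  proof -
    have "dispersion (mix k) \<le> (1 - c) * V k"
      unfolding mix_def [abs_def] V_def c_def
      by (rule dispersion_doubly_stochastic_le [where E = "E (Suc k)"])
         (use stochastic connected eta_diag eta_edge eta_pos in auto)
    then have mix: "(1 + c) * dispersion (mix k) \<le> (1 + c) * ((1 - c) * V k)"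
      using c_pos by (intro mult_left_mono) auto
    have "dispersion (\<lambda>i. a k *\<^sub>R G k i) \<le> (\<Sum>i\<in>UNIV. (norm (a k *\<^sub>R G k i))\<^sup>2)"
      by (rule dispersion_le_sum_norm_squares)
    also have "\<dots> \<le> (\<Sum>i\<in>(UNIV::'m set). (a k * C)\<^sup>2)"
      using a_pos [of k] G_le by (intro sum_mono power_mono) (auto intro: mult_left_mono)
    also have "\<dots> = ?m * C\<^sup>2 * (a k)\<^sup>2"
      by (simp add: power_mult_distrib)
    finally have grad: "(1 + 1 / c) * dispersion (\<lambda>i. a k *\<^sub>R G k i) \<le> (1 + 1 / c) * (?m * C\<^sup>2 * (a k)\<^sup>2)"
      using c_pos by (intro mult_left_mono) auto
    have "V (Suc k) \<le> (1 + c) * dispersion (mix k) + (1 + 1 / c) * dispersion (\<lambda>i. a k *\<^sub>R G k i)"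
      unfolding V_def P_Suc by (rule dispersion_diff_le [OF c_pos])
    with mix grad show ?thesis
      by (simp add: algebra_simps power2_eq_square)
  qed
  have "summable (\<lambda>k. c\<^sup>2 * V k)"
    by (rule quasi_decreasing_convergent_summable(2) [where a = V, OF V_nonneg _ _ V_Suc])
       (use V_nonneg sum_a2 in \<open>auto intro: summable_mult\<close>)
  then have sum_V: "summable V"
    using summable_mult_D [of "c\<^sup>2" V] c_pos by simp
  obtain A where A: "\<And>k. a k \<le> A"
  proof -
    have "(\<lambda>k. sqrt ((a k)\<^sup>2)) \<longlonglongrightarrow> sqrt 0"
      by (intro tendsto_real_sqrt summable_LIMSEQ_zero sum_a2)
    then have "a \<longlonglongrightarrow> 0"
      using a_pos by (simp add: less_imp_le)
    then have "Bseq a"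
      using convergentI convergent_imp_Bseq by blast
    then show ?thesis
      using that by (metis BseqE abs_le_D1 real_norm_def)
  qed
  have sum_aV: "summable (\<lambda>k. a k * V k)"
  proof (rule summable_comparison_test')
    show "summable (\<lambda>k. A * V k)"
      by (rule summable_mult [OF sum_V])
    show "norm (a k * V k) \<le> A * V k" if "k \<ge> 0" for k
      using A [of k] a_pos [of k] V_nonneg [of k] by (simp add: mult_right_mono)
  qed

  \<comment> \<open>the error terms of one step of the average, summable by the step size conditions and by agreement\<close>
  define e where "e k = 2 * (a k * \<delta> (Suc k)) + a k * Lmax / ?m * V k + (a k)\<^sup>2 * C\<^sup>2" for k
  have sum_e: "summable e"
  proof -
    have "summable (\<lambda>k. 2 * (a k * \<delta> (Suc k)) + Lmax / ?m * (a k * V k) + (a k)\<^sup>2 * C\<^sup>2)"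
      using step_delta by (intro summable_add summable_mult summable_mult2 sum_aV sum_a2) (simp add: a_def)
    then show ?thesis
      by (simp add: e_def [abs_def] mult_ac)
  qed
  have dist_step: "(norm (z (Suc k) - y))\<^sup>2 \<le> (norm (z k - y))\<^sup>2 - 2 / ?m * (a k * (F (z k) - fstar)) + e k"
    if "y \<in> Xstar" for k y
  proof -
    have "(norm (z k - a k *\<^sub>R avg (G k) - y))\<^sup>2 \<le> (norm (z k - y))\<^sup>2
       - 2 * a k / ?m * (F (z k) - F y) + e k"
      unfolding z_def e_def V_def F
      by (rule average_step_distance_le [where L = "L (Suc k)" and c = "\<lambda>i. fd i (Suc k)"])
         (use oracle_output L_bound G_le a_pos in \<open>auto simp: P_def G_def less_imp_le\<close>)
    moreover have "F y = fstar"
      using that Xstar by simp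
    ultimately show ?thesis
      by (simp add: z_Suc mult_ac)
  qed
  have gap_nonneg: "0 \<le> F (z k) - fstar" for k
    using fstar_lower by simp
  have drop_nonneg: "0 \<le> 2 / ?m * (a k * (F (z k) - fstar))" for k
    using a_pos [of k] gap_nonneg [of k] by simp
  have fejer: "convergent (\<lambda>k. (norm (z k - y))\<^sup>2)"
      "summable (\<lambda>k. 2 / ?m * (a k * (F (z k) - fstar)))" if "y \<in> Xstar" for y
    using quasi_decreasing_convergent_summable [where a = "\<lambda>k. (norm (z k - y))\<^sup>2",
        OF zero_le_power2 drop_nonneg sum_e dist_step [OF that]] by blast+

  have conv_z: "convergent (\<lambda>k. norm (z k - y))" if y: "y \<in> Xstar" for y
  proof -
    obtain l where "(\<lambda>k. (norm (z k - y))\<^sup>2) \<longlonglongrightarrow> l"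
      using fejer(1) [OF y] by (auto simp: convergent_def)
    then have "(\<lambda>k. sqrt ((norm (z k - y))\<^sup>2)) \<longlonglongrightarrow> sqrt l"
      by (rule tendsto_real_sqrt)
    then show ?thesis
      by (auto simp: convergent_def)
  qed
  then have part_a: "\<forall>xstar\<in>Xstar. convergent (\<lambda>k. norm (xav k - xstar))"
    by (subst convergent_Suc_iff [symmetric]) (simp add: z)

  obtain y0 where y0: "y0 \<in> Xstar"
    using Xstar_nonempty by blast
  have sum_gap: "summable (\<lambda>k. a k * (F (z k) - fstar))"
    using summable_mult_D [OF fejer(2) [OF y0]] by simp
  have not_sum_a: "\<not> summable a"
  proof
    assume "summable a"
    then have "convergent (\<lambda>n. \<Sum>k<n. a k)"
      by (simp add: summable_iff_convergent)
    moreover have "(\<Sum>k=1..n. \<alpha> k) = (\<Sum>k<n. a k)" for n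
      using sum.atLeast1_atMost_eq [of \<alpha> n] by (simp add: a_def)
    ultimately obtain l where "(\<lambda>n. \<Sum>k=1..n. \<alpha> k) \<longlonglongrightarrow> l"
      by (auto simp: convergent_def)
    then show False
      by (rule not_tendsto_and_filterlim_at_infinity
          [OF trivial_limit_sequentially _ filterlim_at_top_imp_at_infinity [OF step_diverge]])
  qed
  obtain r :: "nat \<Rightarrow> nat" where r: "strict_mono r"
      and gap_r: "((\<lambda>k. F (z k) - fstar) \<circ> r) \<longlonglongrightarrow> 0"
    using weighted_summable_subseq_tendsto_zero
      [of a "\<lambda>k. F (z k) - fstar", OF less_imp_le [OF a_pos] gap_nonneg sum_gap not_sum_a] by blast
  have "Bseq (\<lambda>k. norm (z k - y0))"
    by (intro convergent_imp_Bseq conv_z y0)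
  then have "bounded (range z)"
  proof -
    obtain K where K: "\<And>k. norm (z k - y0) \<le> K"
      using \<open>Bseq (\<lambda>k. norm (z k - y0))\<close> by (auto simp: Bseq_def)
    have "range z \<subseteq> cball y0 K"
      using K by (auto simp: dist_norm norm_minus_commute)
    then show ?thesis
      using bounded_cball bounded_subset by blast
  qed
  then have "bounded (range (z \<circ> r))"
    by (rule bounded_subset) auto
  then obtain xbar s where s: "strict_mono (s :: nat \<Rightarrow> nat)" and lim: "((z \<circ> r) \<circ> s) \<longlonglongrightarrow> xbar"
    using bounded_imp_convergent_subsequence by blast
  have contF: "isCont F xbar"
  proof -
    have "continuous_on UNIV (\<lambda>y. \<Sum>i\<in>UNIV. f i y)"
      by (intro continuous_on_sum continuous)
    then show ?thesis
      unfolding F [symmetric] by (simp add: continuous_on_eq_continuous_at)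
  qed
  have "(\<lambda>k. F (((z \<circ> r) \<circ> s) k)) \<longlonglongrightarrow> F xbar"
    by (rule isCont_tendsto_compose [OF contF lim])
  moreover have "(\<lambda>k. F (((z \<circ> r) \<circ> s) k)) \<longlonglongrightarrow> fstar"
    using tendsto_add [OF LIMSEQ_subseq_LIMSEQ [OF gap_r s] tendsto_const [of fstar]] by (simp add: o_def)
  ultimately have "F xbar = fstar"
    using LIMSEQ_unique by blast
  then have xbar: "xbar \<in> Xstar"
    by (simp add: Xstar)
  have "cluster_point xav xbar"
    unfolding cluster_point_def
  proof (intro exI conjI)
    show "strict_mono (\<lambda>k. Suc (r (s k)))"
      using r s by (auto simp: strict_mono_def)
    show "(xav \<circ> (\<lambda>k. Suc (r (s k)))) \<longlonglongrightarrow> xbar"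
      using lim by (simp add: o_def z)
  qed
  with xbar have part_b: "\<exists>xbar. cluster_point xav xbar \<and> xbar \<in> Xstar"
    by blast

  \<comment> \<open>The distances of \<open>z\<close> to \<open>xbar\<close> converge and their limit is 0 along a subsequence.\<close>
  have part_c: "(\<lambda>k. x i k) \<longlonglongrightarrow> xstar" if "Xstar = {xstar}" for xstar i
  proof -
    have xs: "xstar = xbar"
      using xbar that by simp
    obtain l where l: "(\<lambda>k. norm (z k - xbar)) \<longlonglongrightarrow> l"
      using conv_z [OF xbar] by (auto simp: convergent_def)
    have "(\<lambda>k. norm (z (r (s k)) - xbar)) \<longlonglongrightarrow> l"
      using LIMSEQ_subseq_LIMSEQ [OF l strict_mono_o [OF r s]] by (simp add: o_def)
    moreover have "(\<lambda>k. norm (z (r (s k)) - xbar)) \<longlonglongrightarrow> 0"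
      using lim by (simp add: o_def LIM_zero tendsto_norm_zero)
    ultimately have "l = 0"
      using LIMSEQ_unique by blast
    with l have "(\<lambda>k. z k - xbar) \<longlonglongrightarrow> 0"
      by (simp add: tendsto_norm_zero_iff)
    moreover have "(\<lambda>k. P k i - z k) \<longlonglongrightarrow> 0"
    proof -
      have "(\<lambda>k. sqrt (V k)) \<longlonglongrightarrow> 0"
        using tendsto_real_sqrt [OF summable_LIMSEQ_zero [OF sum_V]] by simp
      moreover have "norm (P k i - z k) \<le> sqrt (V k)" for k
        unfolding z_def V_def by (intro real_le_rsqrt norm_diff_avg_le_dispersion)
      ultimately show ?thesis
        using Lim_null_comparison [of "\<lambda>k. P k i - z k" "\<lambda>k. sqrt (V k)" sequentially] by simp
    qed
    ultimately have "(\<lambda>k. (P k i - z k) + (z k - xbar)) \<longlonglongrightarrow> 0 + 0"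
      by (intro tendsto_add)
    then have "(\<lambda>k. P k i) \<longlonglongrightarrow> xbar"
      by (simp add: LIM_zero_iff)
    then show ?thesis
      unfolding P_def xs by (rule LIMSEQ_imp_Suc)
  qed
  show ?thesis
    by (intro conjI part_a part_b allI impI part_c)
qed

end
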